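(* Fix a permutation $p:\mathbb N\to\mathbb N$, $n\mapsto n'$. Let $r_n\in[0,1)$, $n\ge 1$, with $\sum_n r_n^2<\infty$, and let $w_n=r_ne^{iq_n}$, where the phases $q_n$ are independent and uniformly distributed random angles. Then almost surely $\sigma(w)=\sigma(p,w)$ is a homeomorphism of $S^1$.
   Context: $\Delta=\{|w|<1\}$, $S^1=\{|z|=1\}$. For $n\ge1$ and $w_n\in\Delta$, $\phi_n(w_n;z)=z\,(1+\bar w_nz^{-n})^{1/n}/(1+w_nz^n)^{1/n}$, $|z|=1$ (principal branches). For $w=(w_n)\in\prod_{n\ge1}\Delta$ put $\sigma_N=\phi_{N'}(w_{N'})\circ\cdots\circ\phi_{1'}(w_{1'})$. If $\sum_n\frac1n|w_n|<\infty$ (in particular if $w\in l^2$), then $\sigma(p,w;z)=\lim_{N\to\infty}\sigma_N(z)$ exists uniformly on $S^1$ and is a degree one, surjective, continuous map $S^1\to S^1$. *)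

theory Defs
  imports "HOL-Probability.Probability"
begin

text \<open>
  The complex \<open>powr\<close> is the principal branch. For \<open>norm w < 1\<close> and \<open>norm z = 1\<close> both bases lie
  in the right half plane, away from the branch cut.
\<close>

definition root_phi :: "nat \<Rightarrow> complex \<Rightarrow> complex \<Rightarrow> complex" where
  "root_phi n w z =
     z * (1 + cnj w * z powi (- int n)) powr (1 / of_nat n) / (1 + w * z ^ n) powr (1 / of_nat n)"

text \<open>
  Indices start at 1: \<open>p\<close> is used as a permutation of \<open>{1..}\<close>, and \<open>p 0\<close> and \<open>w 0\<close> never matter.
\<close>

primrec sigmaN :: "(nat \<Rightarrow> nat) \<Rightarrow> (nat \<Rightarrow> complex) \<Rightarrow> nat \<Rightarrow> complex \<Rightarrow> complex" where
  "sigmaN p w 0 = id"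
| "sigmaN p w (Suc N) = root_phi (p (Suc N)) (w (p (Suc N))) \<circ> sigmaN p w N"

definition sigma_lim :: "(nat \<Rightarrow> nat) \<Rightarrow> (nat \<Rightarrow> complex) \<Rightarrow> complex \<Rightarrow> complex" where
  "sigma_lim p w z = lim (\<lambda>N. sigmaN p w N z)"

end

theory Submission
  imports Defs
begin

text \<open>
  The maps \<open>\<phi>\<^sub>n\<close> lift to increasing diffeomorphisms of the line, and the displacements of these lifts
  are at most \<open>8 r\<^sub>n / n\<close>, which is summable because \<open>r\<close> is square summable. So for every choice
  of phases the lifts of \<open>\<sigma>\<^sub>N\<close> converge uniformly to a continuous nondecreasing \<open>F\<close> that commutes with
  the translation by \<open>2\<pi>\<close>, and the limit on the circle is a homeomorphism as soon as \<open>F\<close> has no flat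
  piece. What has to be excluded, almost surely, is that \<open>\<sigma>\<^sub>N\<close> squeezes some arc with rational
  endpoints \<open>a < b\<close> to a point.

  Let \<open>W\<^sub>N\<close> be the reciprocal of the length of the image of \<open>[a, b]\<close> under the \<open>N\<close>-th lift. The claim
  is that the expectation of \<open>W\<^sub>N\<close> stays bounded. The derivative of the lift of \<open>\<phi>\<^sub>n\<close> is the Poisson kernel
  \<open>(1 - r\<^sup>2) / (1 + r\<^sup>2 + 2 r cos (n\<theta> + q))\<close>, whose reciprocal is a trigonometric polynomial with mean
  \<open>(1 + r\<^sup>2) / (1 - r\<^sup>2)\<close> over the phase \<open>q\<close>. The Cauchy-Schwarz inequality
  \<open>(b - a)\<^sup>2 \<le> (\<integral>f') (\<integral>1/f')\<close> turns this into an upper bound for the reciprocal of the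
  image length (\<open>circle_lift_reciprocal_increment\<close>): it is \<open>(1 + r\<^sup>2) / (1 - r\<^sup>2)\<close> times the old reciprocal,
  plus an oscillating term linear in \<open>cos q\<close> and \<open>sin q\<close>. The new phase is uniform and independent of
  the earlier ones, hence of the arc to which the new map is applied, so the oscillating term has mean zero
  and \<open>E W\<^sub>N\<^sub>+\<^sub>1 \<le> (1 + r\<^sup>2) / (1 - r\<^sup>2) E W\<^sub>N\<close> (\<open>expectation_reciprocal_gap_Suc\<close>). The product of these
  factors converges because \<open>r\<close> is square summable. By Fatou's lemma the lower limit of \<open>W\<^sub>N\<close> is almost surely
  finite, so the image lengths do not tend to zero. There are only countably many rational arcs.
\<close>

section \<open>Lifts to the real line\<close>

text \<open>
  The quotient under the arctangent is the tangent of the argument of \<open>1 + w z\<^sup>n\<close> for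
  \<open>w = r e\<^sup>i\<^sup>q\<close> and \<open>z = e\<^sup>i\<^sup>t\<close>, a number in the right half plane. The real form makes differentiability
  and measurability immediate.
\<close>

definition circle_lift :: "nat \<Rightarrow> real \<Rightarrow> real \<Rightarrow> real \<Rightarrow> real" where
  "circle_lift n r q t =
     t - 2 / real n * arctan (r * sin (real n * t + q) / (1 + r * cos (real n * t + q)))"

text \<open>
  The radii and the phases are separate arguments so that the composition is an explicit function of the
  random phases.
\<close>

primrec sigma_lift :: "(nat \<Rightarrow> nat) \<Rightarrow> (nat \<Rightarrow> real) \<Rightarrow> (nat \<Rightarrow> real) \<Rightarrow> nat \<Rightarrow> real \<Rightarrow> real" where
  "sigma_lift p r q 0 t = t"
| "sigma_lift p r q (Suc N) t =
     circle_lift (p (Suc N)) (r (p (Suc N))) (q (p (Suc N))) (sigma_lift p r q N t)"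

lemma one_plus_r_cos_pos:
  fixes r x :: real
  assumes "0 \<le> r" "r < 1"
  shows "1 + r * cos x > 0"
proof -
  have "\<bar>r * cos x\<bar> \<le> r * 1"
    unfolding abs_mult using assms by (intro mult_mono) auto
  then show ?thesis using assms by linarith
qed

lemma poisson_denominator_pos:
  fixes r x :: real
  assumes "0 \<le> r" "r < 1"
  shows "1 + r\<^sup>2 + 2 * r * cos x > 0"
proof -
  have "1 + r\<^sup>2 + 2 * r * cos x = (1 - r)\<^sup>2 + 2 * r * (1 + cos x)"
    by (simp add: power2_eq_square algebra_simps)
  moreover have "(1 - r)\<^sup>2 > 0" using assms by simp
  moreover have "2 * r * (1 + cos x) \<ge> 0"
    using assms cos_ge_minus_one[of x] by (intro mult_nonneg_nonneg) linarith+
  ultimately show ?thesis by linarith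
qed

text \<open>
  On the circle the two bases in the definition of \<open>\<phi>\<^sub>n\<close> are complex conjugate. Both lie off the branch
  cut, so their principal logarithms are conjugate too, and the quotient of the two roots is a pure
  rotation by \<open>-2/n\<close> times the argument of the denominator.
\<close>

lemma root_phi_cis:
  assumes n: "n \<ge> 1" and r: "0 \<le> r" "r < 1"
  shows "root_phi n (complex_of_real r * cis q) (cis t) = cis (circle_lift n r q t)"
proof -
  define u where "u = 1 + complex_of_real r * cis (real n * t + q)"
  define a where "a = arctan (r * sin (real n * t + q) / (1 + r * cos (real n * t + q)))"
  have Re_u: "Re u = 1 + r * cos (real n * t + q)" and Im_u: "Im u = r * sin (real n * t + q)"
    by (simp_all add: u_def)
  have pos: "Re u > 0" using one_plus_r_cos_pos[OF r] by (simp add: Re_u)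
  then have u0: "u \<noteq> 0" "cnj u \<noteq> 0" by auto
  have den: "1 + complex_of_real r * cis q * cis t ^ n = u"
  proof -
    have "cis q * cis t ^ n = cis (real n * t + q)"
      by (simp only: Complex.DeMoivre cis_mult add.commute)
    then show ?thesis by (simp add: u_def mult.assoc)
  qed
  have num: "1 + cnj (complex_of_real r * cis q) * cis t powi (- int n) = cnj u"
    unfolding den[symmetric] by (simp add: power_int_minus cis_cnj flip: power_inverse)
  have nonreal: "u \<notin> \<real>\<^sub>\<le>\<^sub>0" using pos by (auto simp: complex_nonpos_Reals_iff)
  have Lnc: "Ln (cnj u) = cnj (Ln u)" using nonreal by (rule cnj_Ln[symmetric])
  have ImL: "Im (Ln u) = a"
    using arg_conv_arctan[OF pos] Arg_eq_Im_Ln[OF u0(1)] by (simp add: a_def Re_u Im_u)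
  have diff: "cnj (Ln u) - Ln u = - 2 * \<i> * of_real a"
    by (rule complex_eqI) (simp_all add: ImL)
  have "cnj u powr (1 / of_nat n) / u powr (1 / of_nat n)
      = exp ((cnj (Ln u) - Ln u) / of_nat n)"
    using u0 by (simp add: powr_def Lnc diff_divide_distrib flip: exp_diff)
  also have "\<dots> = cis (- 2 / real n * a)"
    unfolding diff by (simp add: cis_conv_exp mult_ac)
  finally have "root_phi n (complex_of_real r * cis q) (cis t) = cis t * cis (- 2 / real n * a)"
    unfolding root_phi_def num den by (simp only: times_divide_eq_right[symmetric])
  then show ?thesis by (simp add: cis_mult circle_lift_def a_def)
qed

lemma sigmaN_cis:
  assumes "\<And>n. n \<ge> 1 \<Longrightarrow> p n \<ge> 1" "\<And>n. n \<ge> 1 \<Longrightarrow> 0 \<le> r n \<and> r n < 1"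
  shows "sigmaN p (\<lambda>n. complex_of_real (r n) * cis (q n)) N (cis t) = cis (sigma_lift p r q N t)"
  using assms by (induction N) (simp_all add: root_phi_cis)

text \<open>The stretching factor is the Poisson kernel, as for the disc automorphism covered by \<open>\<phi>\<^sub>n\<close>.\<close>

lemma circle_lift_has_derivative:
  assumes n: "n \<ge> 1" and r: "0 \<le> r" "r < 1"
  shows "(circle_lift n r q has_real_derivative
           (1 - r\<^sup>2) / (1 + r\<^sup>2 + 2 * r * cos (real n * t + q))) (at t)"
proof -
  define c s where "c = cos (real n * t + q)" and "s = sin (real n * t + q)"
  have d: "1 + r * c > 0" unfolding c_def by (rule one_plus_r_cos_pos[OF r])
  have P: "1 + r\<^sup>2 + 2 * r * c > 0" unfolding c_def by (rule poisson_denominator_pos[OF r])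
  have cs: "s\<^sup>2 = 1 - c\<^sup>2" by (simp add: c_def s_def sin_squared_eq)
  have sum: "(1 + r * c)\<^sup>2 + (r * s)\<^sup>2 = 1 + r\<^sup>2 + 2 * r * c"
    unfolding power_mult_distrib cs by (simp add: power2_eq_square algebra_simps)
  have P': "1 + (r * s / (1 + r * c))\<^sup>2 = (1 + r\<^sup>2 + 2 * r * c) / (1 + r * c)\<^sup>2"
    using d by (simp add: sum[symmetric] power_divide add_divide_distrib)
  have "((\<lambda>t. r * sin (real n * t + q) / (1 + r * cos (real n * t + q))) has_real_derivative
      (r * (c * real n) * (1 + r * c) - r * s * (r * (- s * real n))) / ((1 + r * c) * (1 + r * c))) (at t)"
    using d by (auto intro!: derivative_eq_intros simp: c_def s_def)
  from DERIV_diff[OF DERIV_ident DERIV_cmult[OF DERIV_chain2[OF DERIV_arctan this], of "2 / real n"]]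
  have "(circle_lift n r q has_real_derivative
      1 - 2 / real n * (inverse (1 + (r * s / (1 + r * c))\<^sup>2) *
        ((r * (c * real n) * (1 + r * c) - r * s * (r * (- s * real n)))
           / ((1 + r * c) * (1 + r * c))))) (at t)"
    unfolding circle_lift_def [abs_def] c_def s_def .
  also have "1 - 2 / real n * (inverse (1 + (r * s / (1 + r * c))\<^sup>2) *
        ((r * (c * real n) * (1 + r * c) - r * s * (r * (- s * real n)))
           / ((1 + r * c) * (1 + r * c))))
      = 1 - 2 * ((r * c * (1 + r * c) + r\<^sup>2 * s\<^sup>2) / (1 + r\<^sup>2 + 2 * r * c))"
  proof -
    have num: "r * (c * real n) * (1 + r * c) - r * s * (r * (- s * real n))
        = real n * (r * c * (1 + r * c) + r\<^sup>2 * s\<^sup>2)"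
      by (simp add: power2_eq_square algebra_simps)
    have "2 / real n * (inverse (x / y\<^sup>2) * (real n * z / (y * y))) = 2 * (z / x)"
      if "y > 0" for x y z :: real
      using n that by (simp add: power2_eq_square)
    from this[OF d] show ?thesis unfolding P' num by simp
  qed
  also have "r * c * (1 + r * c) + r\<^sup>2 * s\<^sup>2 = r * c + r\<^sup>2"
    unfolding cs by (simp add: power2_eq_square algebra_simps)
  also have "1 - 2 * ((r * c + r\<^sup>2) / (1 + r\<^sup>2 + 2 * r * c)) = (1 - r\<^sup>2) / (1 + r\<^sup>2 + 2 * r * c)"
    using P by (simp add: field_simps)
  finally show ?thesis by (simp add: c_def)
qed

lemma circle_lift_strict_mono:
  assumes "n \<ge> 1" "0 \<le> r" "r < 1" "a < b"
  shows "circle_lift n r q a < circle_lift n r q b"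
proof (rule DERIV_pos_imp_increasing[OF \<open>a < b\<close>], intro exI conjI)
  fix x
  show "(circle_lift n r q has_real_derivative
           (1 - r\<^sup>2) / (1 + r\<^sup>2 + 2 * r * cos (real n * x + q))) (at x)"
    by (rule circle_lift_has_derivative) fact+
  show "(1 - r\<^sup>2) / (1 + r\<^sup>2 + 2 * r * cos (real n * x + q)) > 0"
    using assms by (intro divide_pos_pos poisson_denominator_pos) (simp_all add: power_less_one_iff)
qed

lemma continuous_on_circle_lift:
  assumes "n \<ge> 1" "0 \<le> r" "r < 1"
  shows "continuous_on A (circle_lift n r q)"
  using circle_lift_has_derivative[OF assms] DERIV_isCont
  by (metis continuous_at_imp_continuous_on)

lemma circle_lift_periodic:
  "circle_lift n r q (t + 2 * pi) = circle_lift n r q t + 2 * pi"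
proof -
  have *: "real n * (t + 2 * pi) + q = (real n * t + q) + 2 * pi * real n"
    by (simp add: algebra_simps)
  have **: "sin (2 * pi * real n) = 0" "cos (2 * pi * real n) = 1"
    using sin_int_2pin[of "int n"] cos_int_2pin[of "int n"] by simp_all
  have "sin (real n * (t + 2 * pi) + q) = sin (real n * t + q)"
       "cos (real n * (t + 2 * pi) + q) = cos (real n * t + q)"
    unfolding * sin_add[of "real n * t + q" "2 * pi * real n"]
      cos_add[of "real n * t + q" "2 * pi * real n"] ** by simp_all
  then show ?thesis by (simp add: circle_lift_def)
qed

text \<open>
  For small \<open>r\<close> the arctangent is controlled by its argument; for \<open>r > 1/2\<close> it is enough that it is
  smaller than \<open>\<pi>/2 \<le> 2\<close>. The factor \<open>1/n\<close> is what makes the displacements summable for square summable \<open>r\<close>.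
\<close>

lemma circle_lift_displacement:
  assumes r: "0 \<le> r" "r < 1"
  shows "\<bar>circle_lift n r q t - t\<bar> \<le> 8 * r / real n"
proof -
  define x where "x = r * sin (real n * t + q) / (1 + r * cos (real n * t + q))"
  have "\<bar>arctan x\<bar> \<le> 4 * r"
  proof (cases "r \<le> 1/2")
    case True
    have "- 1 * r \<le> cos (real n * t + q) * r"
      using r by (intro mult_right_mono) auto
    then have den: "1 + r * cos (real n * t + q) \<ge> 1/2"
      using True by (simp add: mult.commute)
    have "\<bar>r * sin (real n * t + q)\<bar> \<le> r * 1"
      unfolding abs_mult using r by (intro mult_mono) auto
    then have "\<bar>x\<bar> \<le> r / (1/2)"
      unfolding x_def abs_divide using den r by (intro frac_le) auto
    then show ?thesis using abs_arctan_le[of x] r by simp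
  next
    case False
    then show ?thesis using arctan_bounded[of x] pi_less_4 by auto
  qed
  then have "2 / real n * \<bar>arctan x\<bar> \<le> 2 / real n * (4 * r)"
    by (intro mult_left_mono) auto
  then show ?thesis by (simp add: circle_lift_def x_def abs_mult)
qed

text \<open>
  This is the Cauchy-Schwarz inequality for the square roots of \<open>f'\<close> and \<open>1/f'\<close>. It follows without
  integrals because \<open>1/f' - 2k + k\<^sup>2 f'\<close> is nonnegative for every \<open>k\<close>; the optimal \<open>k\<close> is the inverse of
  the mean slope of \<open>f\<close>.
\<close>

lemma square_le_increment_mult_reciprocal_increment:
  fixes f F f' :: "real \<Rightarrow> real"
  assumes ab: "a < b"
    and f: "\<And>t. (f has_real_derivative f' t) (at t)"
    and F: "\<And>t. (F has_real_derivative 1 / f' t) (at t)"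
    and pos: "\<And>t. f' t > 0"
  shows "(b - a)\<^sup>2 \<le> (f b - f a) * (F b - F a)"
proof -
  have inc: "f b - f a > 0"
    using DERIV_pos_imp_increasing[OF ab] f pos by (metis diff_gt_0_iff_gt)
  define k where "k = (b - a) / (f b - f a)"
  have "F a - 2 * k * a + k\<^sup>2 * f a \<le> F b - 2 * k * b + k\<^sup>2 * f b"
  proof (rule DERIV_nonneg_imp_nondecreasing[of a b "\<lambda>t. F t - 2 * k * t + k\<^sup>2 * f t"])
    fix t
    have "((\<lambda>t. F t - 2 * k * t + k\<^sup>2 * f t) has_real_derivative
        1 / f' t - 2 * k + k\<^sup>2 * f' t) (at t)"
      using f F by (auto intro!: derivative_eq_intros)
    moreover have "1 / f' t - 2 * k + k\<^sup>2 * f' t = (1 - k * f' t)\<^sup>2 / f' t"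
      using pos[of t] by (simp add: field_simps power2_eq_square)
    moreover have "\<dots> \<ge> 0" using pos[of t] by simp
    ultimately show "\<exists>y. ((\<lambda>t. F t - 2 * k * t + k\<^sup>2 * f t) has_real_derivative y) (at t) \<and> y \<ge> 0"
      by metis
  qed (use ab in simp)
  then have "2 * k * (b - a) - k\<^sup>2 * (f b - f a) \<le> F b - F a"
    by (simp add: algebra_simps)
  also have "2 * k * (b - a) - k\<^sup>2 * (f b - f a) = (b - a)\<^sup>2 / (f b - f a)"
  proof -
    have *: "2 * (x / y) * x - (x / y)\<^sup>2 * y = x\<^sup>2 / y" if "y > 0" for x y :: real
      using that by (simp add: field_simps power2_eq_square)
    show ?thesis unfolding k_def using inc by (intro *)
  qed
  finally show ?thesis
    using inc by (simp add: pos_divide_le_eq mult.commute)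
qed

text \<open>
  The reciprocal of the Poisson kernel has an elementary antiderivative. The second summand is linear in
  \<open>sin q\<close> and \<open>cos q\<close>, so it disappears on averaging over \<open>q\<close>.
\<close>

lemma circle_lift_reciprocal_increment:
  assumes n: "n \<ge> 1" and r: "0 \<le> r" "r < 1" and ab: "a < b"
  shows "1 / (circle_lift n r q b - circle_lift n r q a)
    \<le> (1 + r\<^sup>2) / (1 - r\<^sup>2) * (1 / (b - a))
      + 2 * r / (real n * (1 - r\<^sup>2)) * ((1 / (b - a))\<^sup>2 * (sin (real n * b + q) - sin (real n * a + q)))"
proof -
  define K where "K = 1 - r\<^sup>2"
  have K: "K > 0" using r by (simp add: K_def power_less_one_iff)
  define F where "F = (\<lambda>t. ((1 + r\<^sup>2) * t + 2 * r / real n * sin (real n * t + q)) / K)"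
  let ?f' = "\<lambda>t. K / (1 + r\<^sup>2 + 2 * r * cos (real n * t + q))"
  have inc: "circle_lift n r q b - circle_lift n r q a > 0"
    using circle_lift_strict_mono[OF n r ab] by simp
  have "(b - a)\<^sup>2 \<le> (circle_lift n r q b - circle_lift n r q a) * (F b - F a)"
  proof (rule square_le_increment_mult_reciprocal_increment[OF ab, where f' = ?f'])
    fix t
    show "(circle_lift n r q has_real_derivative ?f' t) (at t)"
      unfolding K_def by (rule circle_lift_has_derivative[OF n r])
    show "?f' t > 0" using K poisson_denominator_pos[OF r] by simp
    show "(F has_real_derivative 1 / ?f' t) (at t)"
      unfolding F_def using K n by (auto intro!: derivative_eq_intros simp: field_simps)
  qed
  then have "1 / (circle_lift n r q b - circle_lift n r q a) \<le> (F b - F a) / (b - a)\<^sup>2"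
    using inc ab by (simp add: field_simps)
  also have "F b - F a = ((1 + r\<^sup>2) * (b - a)
      + 2 * r / real n * (sin (real n * b + q) - sin (real n * a + q))) / K"
    unfolding F_def diff_divide_distrib[symmetric] by (simp add: algebra_simps)
  also have "(C * d + 2 * r / real n * S) / K / d\<^sup>2
      = C / K * (d / d\<^sup>2) + 2 * r / (real n * K) * (1 / d\<^sup>2 * S)" for C d S :: real
    by (simp add: add_divide_distrib)
  also have "(b - a) / (b - a)\<^sup>2 = 1 / (b - a)"
    using ab by (simp add: power2_eq_square)
  finally show ?thesis by (simp add: K_def power_divide)
qed

text \<open>
  A bound that holds for every phase. It makes all the reciprocal lengths bounded random
  variables, hence integrable.
\<close>

lemma circle_lift_increment_bound:
  assumes n: "n \<ge> 1" and r: "0 \<le> r" "r < 1" and ab: "a < b"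
  shows "1 / (circle_lift n r q b - circle_lift n r q a) \<le> (1 + r) / (1 - r) * (1 / (b - a))"
proof -
  have K: "1 - r\<^sup>2 > 0" using r by (simp add: power_less_one_iff)
  define d where "d = real n * (b - a) / 2"
  have d: "d \<ge> 0" using ab by (simp add: d_def)
  have "sin (real n * b + q) - sin (real n * a + q)
      = 2 * (sin d * cos ((real n * b + q + (real n * a + q)) / 2))"
    by (subst sin_diff_sin) (simp add: d_def algebra_simps)
  also have "\<bar>sin d * cos ((real n * b + q + (real n * a + q)) / 2)\<bar> \<le> \<bar>d\<bar> * 1"
    unfolding abs_mult by (intro mult_mono abs_sin_x_le_abs_x) auto
  then have "2 * (sin d * cos ((real n * b + q + (real n * a + q)) / 2)) \<le> 2 * d"
    using d by linarith
  finally have S: "sin (real n * b + q) - sin (real n * a + q) \<le> real n * (b - a)"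
    by (simp add: d_def)
  have "2 * r / (real n * (1 - r\<^sup>2)) * ((1 / (b - a))\<^sup>2 * (sin (real n * b + q) - sin (real n * a + q)))
     \<le> 2 * r / (real n * (1 - r\<^sup>2)) * ((1 / (b - a))\<^sup>2 * (real n * (b - a)))"
    using S K r by (intro mult_left_mono) auto
  also have "\<dots> = 2 * r / (1 - r\<^sup>2) * (1 / (b - a))"
  proof -
    have "x / (real n * y) * ((1 / d)\<^sup>2 * (real n * d)) = x / y * (1 / d)" if "d > 0" for x y d :: real
      using n that by (simp add: power2_eq_square)
    from this[of "b - a"] show ?thesis using ab by (simp only: diff_gt_0_iff_gt)
  qed
  finally have "1 / (circle_lift n r q b - circle_lift n r q a)
     \<le> (1 + r\<^sup>2) / (1 - r\<^sup>2) * (1 / (b - a)) + 2 * r / (1 - r\<^sup>2) * (1 / (b - a))"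
    using circle_lift_reciprocal_increment[OF n r ab, of q] by linarith
  also have "\<dots> = (1 + r)\<^sup>2 / ((1 + r) * (1 - r)) * (1 / (b - a))"
    by (simp add: power2_eq_square algebra_simps add_divide_distrib)
  also have "\<dots> = (1 + r) / (1 - r) * (1 / (b - a))"
    using r by (simp add: power2_eq_square)
  finally show ?thesis .
qed

section \<open>Degree one maps of the circle\<close>

lemma circle_homeomorphism_of_strictly_increasing_lift:
  fixes f :: "complex \<Rightarrow> complex" and F :: "real \<Rightarrow> real"
  assumes lift: "\<And>t. f (cis t) = cis (F t)"
    and cont: "continuous_on UNIV F"
    and mono: "strict_mono F"
    and per: "\<And>t. F (t + 2 * pi) = F t + 2 * pi"
  shows "\<exists>g. homeomorphism (sphere 0 1) (sphere 0 1) f g"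
proof (rule homeomorphism_compact)
  have circle: "\<exists>t\<in>{0..2 * pi}. z = cis t" if "z \<in> sphere 0 1" for z
  proof -
    have "(Re z)\<^sup>2 + (Im z)\<^sup>2 = 1" using that by (simp flip: cmod_power2)
    then obtain t where "0 \<le> t" "t < 2 * pi" "Re z = cos t" "Im z = sin t"
      by (rule sincos_total_2pi)
    then show ?thesis by (intro bexI[of _ t]) (auto simp: complex_eq_iff)
  qed
  show "compact (sphere 0 1 :: complex set)" by simp
  \<comment> \<open>The circle is a quotient of the compact interval \<open>[0, 2\<pi>]\<close>, so closed preimages can be computed upstairs.\<close>
  show "continuous_on (sphere 0 1) f"
  proof (subst continuous_on_closed_vimage, simp, safe)
    fix C :: "complex set" assume C: "closed C"
    have "closed ((\<lambda>t. cis (F t)) -` C \<inter> {0..2 * pi})"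
      using C by (intro closed_vimage_Int continuous_intros continuous_on_subset[OF cont]) auto
    then have "compact ((\<lambda>t. cis (F t)) -` C \<inter> {0..2 * pi})"
      by (metis closed_Int_compact compact_Icc inf.left_idem inf_commute)
    then have "compact (cis ` ((\<lambda>t. cis (F t)) -` C \<inter> {0..2 * pi}))"
      by (intro compact_continuous_image continuous_intros)
    moreover have "cis ` ((\<lambda>t. cis (F t)) -` C \<inter> {0..2 * pi}) = f -` C \<inter> sphere 0 1"
      using circle by (fastforce simp: lift)
    ultimately show "closed (f -` C \<inter> sphere 0 1)" by (simp add: compact_imp_closed)
  qed
  show "f ` sphere 0 1 = sphere 0 1"
  proof
    show "f ` sphere 0 1 \<subseteq> sphere 0 1" using circle by (fastforce simp: lift)
    show "sphere 0 1 \<subseteq> f ` sphere 0 1"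
    proof
      fix z :: complex assume "z \<in> sphere 0 1"
      then obtain s where s: "z = cis s" using circle by blast
      define k :: int where "k = \<lceil>(F 0 - s) / (2 * pi)\<rceil>"
      have "(F 0 - s) / (2 * pi) \<le> k" "k < (F 0 - s) / (2 * pi) + 1"
        unfolding k_def by linarith+
      then have "F 0 \<le> s + 2 * pi * k" "s + 2 * pi * k \<le> F (0 + 2 * pi)"
        unfolding per by (simp_all add: field_simps)
      then obtain t where "F t = s + 2 * pi * k"
        using IVT'[of F 0 "s + 2 * pi * k" "0 + 2 * pi"] continuous_on_subset[OF cont] by auto
      then have "f (cis t) = z" by (simp add: lift s flip: cis_mult)
      then show "z \<in> f ` sphere 0 1" by force
    qed
  qed
  show "inj_on f (sphere 0 1)"
  proof -
    \<comment> \<open>Unless \<open>s\<close> and \<open>t\<close> are the two ends of the period, \<open>F s\<close> and \<open>F t\<close> differ by less than \<open>2\<pi>\<close>.\<close>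
    have *: "cis s = cis t" if asm: "0 \<le> s" "s \<le> t" "t \<le> 2 * pi" "cis (F s) = cis (F t)" for s t
    proof -
      obtain k :: int where k: "F t = F s + 2 * pi * k"
        using asm(4) sin_cos_eq_iff[of "F t" "F s"] by (auto simp: complex_eq_iff)
      have le: "F s \<le> F t" "F t \<le> F (0 + 2 * pi)" "F 0 \<le> F s"
        by (rule monoD[OF strict_mono_mono[OF mono]]; use asm in simp)+
      show ?thesis
      proof (cases "s = 0 \<and> t = 2 * pi")
        case False
        then have "F 0 < F s \<or> F t < F (0 + 2 * pi)"
          using asm unfolding strict_mono_less[OF mono] by auto
        then have "2 * pi * k < 2 * pi * 1" using le k per[of 0] by linarith
        then have "k < 1" by (simp add: mult_less_cancel_left)
        moreover have "2 * pi * 0 \<le> 2 * pi * k" using le k by linarith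
        then have "k \<ge> 0" using pi_gt_zero by (auto simp: zero_le_mult_iff)
        ultimately have "F s = F t" using k by simp
        then show ?thesis using strict_mono_eq[OF mono] by simp
      qed simp
    qed
    show ?thesis
    proof (rule inj_onI)
      fix x y :: complex assume "x \<in> sphere 0 1" "y \<in> sphere 0 1" "f x = f y"
      with circle obtain s t where "s \<in> {0..2 * pi}" "x = cis s" "t \<in> {0..2 * pi}" "y = cis t"
        by meson
      moreover from this have "cis (F s) = cis (F t)"
        using \<open>f x = f y\<close> by (simp add: lift)
      ultimately show "x = y"
        by (metis * atLeastAtMost_iff linear)
    qed
  qed
qed

section \<open>Uniform convergence of the compositions\<close>

locale phase_chain =
  fixes p :: "nat \<Rightarrow> nat" and r :: "nat \<Rightarrow> real"
  assumes p_ge_1: "n \<ge> 1 \<Longrightarrow> p n \<ge> 1"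
    and p_inj: "inj_on p {1..}"
    and r_bounds: "n \<ge> 1 \<Longrightarrow> 0 \<le> r n \<and> r n < 1"
begin

lemma r_p_bounds: "0 \<le> r (p (Suc N))" "r (p (Suc N)) < 1"
  using r_bounds[OF p_ge_1] by auto

lemma p_Suc_pos: "p (Suc N) \<ge> 1"
  by (rule p_ge_1) simp

lemma sigma_lift_strict_mono: "a < b \<Longrightarrow> sigma_lift p r q N a < sigma_lift p r q N b"
  by (induction N) (auto intro: circle_lift_strict_mono r_p_bounds p_Suc_pos)

lemma sigma_lift_periodic: "sigma_lift p r q N (t + 2 * pi) = sigma_lift p r q N t + 2 * pi"
  by (induction N) (simp_all add: circle_lift_periodic)

lemma continuous_on_sigma_lift: "continuous_on A (sigma_lift p r q N)"
proof (induction N)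
  case (Suc N)
  have "continuous_on A (\<lambda>t. circle_lift (p (Suc N)) (r (p (Suc N))) (q (p (Suc N))) (sigma_lift p r q N t))"
    by (rule continuous_on_compose2[OF continuous_on_circle_lift Suc])
       (use r_p_bounds p_Suc_pos in auto)
  then show ?case by simp
qed (simp add: continuous_on_id[unfolded id_def])

lemma summable_nonneg_reindex_p:
  assumes "summable f" "\<And>n. f n \<ge> (0::real)"
  shows "summable (\<lambda>N. f (p (Suc N)))"
proof -
  have "inj (\<lambda>N. p (Suc N))"
    using p_inj by (auto simp: inj_on_def)
  from summable_reindex[OF assms(1) this assms(2)] show ?thesis by (simp add: o_def)
qed

text \<open>
  Each step moves every point by at most \<open>8 r / n \<le> 4 (r\<^sup>2 + 1/n\<^sup>2)\<close>, independently of the phases, and a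
  rearrangement by \<open>p\<close> does not affect the summability of this bound.
\<close>

lemma sigma_lift_uniform_limit:
  assumes "summable (\<lambda>n. (r n)\<^sup>2)"
  shows "\<exists>F. uniform_limit UNIV (sigma_lift p r q) F sequentially"
proof -
  have "summable (\<lambda>n. 4 * ((r n)\<^sup>2 + 1 / (real n)\<^sup>2))"
    using assms inverse_power_summable[of 2, where ?'a = real]
    by (intro summable_mult summable_add) (simp_all add: inverse_eq_divide)
  then have sum: "summable (\<lambda>N. 4 * ((r (p (Suc N)))\<^sup>2 + 1 / (real (p (Suc N)))\<^sup>2))"
    by (rule summable_nonneg_reindex_p) simp
  have "uniform_limit UNIV (\<lambda>N t. \<Sum>i<N. sigma_lift p r q (Suc i) t - sigma_lift p r q i t)
      (\<lambda>t. suminf (\<lambda>i. sigma_lift p r q (Suc i) t - sigma_lift p r q i t)) sequentially"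
  proof (rule Weierstrass_m_test[OF _ sum])
    fix N t
    have "8 * x / y \<le> 4 * (x\<^sup>2 + 1 / y\<^sup>2)" for x y :: real
      using sum_squares_bound[of x "1 / y"] by (simp add: power_divide)
    then show "norm (sigma_lift p r q (Suc N) t - sigma_lift p r q N t)
        \<le> 4 * ((r (p (Suc N)))\<^sup>2 + 1 / (real (p (Suc N)))\<^sup>2)"
      using circle_lift_displacement[OF r_p_bounds] by (fastforce intro: order_trans)
  qed
  from uniform_limit_add[OF uniform_limit_const[where c = "\<lambda>t. t"] this]
  have "uniform_limit UNIV
      (\<lambda>N t. t + (\<Sum>i<N. sigma_lift p r q (Suc i) t - sigma_lift p r q i t))
      (\<lambda>t. t + suminf (\<lambda>i. sigma_lift p r q (Suc i) t - sigma_lift p r q i t)) sequentially" .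
  also have "(\<lambda>N t. t + (\<Sum>i<N. sigma_lift p r q (Suc i) t - sigma_lift p r q i t)) = sigma_lift p r q"
  proof (intro ext)
    fix N t
    show "t + (\<Sum>i<N. sigma_lift p r q (Suc i) t - sigma_lift p r q i t) = sigma_lift p r q N t"
      using sum_lessThan_telescope[of "\<lambda>i. sigma_lift p r q i t" N] by (simp del: sigma_lift.simps(2))
  qed
  finally show ?thesis by blast
qed

text \<open>
  A nondecreasing limit fails to be strictly increasing only if it is constant on an interval, and
  such an interval contains two rational points.
\<close>

lemma homeomorphism_sigma_lim:
  assumes "summable (\<lambda>n. (r n)\<^sup>2)"
    and gap: "\<And>a b :: rat. a < b \<Longrightarrow>
      \<not> (\<lambda>N. sigma_lift p r q N (of_rat b) - sigma_lift p r q N (of_rat a)) \<longlonglongrightarrow> 0"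
  shows "\<exists>g. homeomorphism (sphere 0 1) (sphere 0 1)
           (sigma_lim p (\<lambda>n. complex_of_real (r n) * cis (q n))) g"
proof -
  obtain F where F: "uniform_limit UNIV (sigma_lift p r q) F sequentially"
    using sigma_lift_uniform_limit[OF assms(1)] by blast
  have lim: "(\<lambda>N. sigma_lift p r q N t) \<longlonglongrightarrow> F t" for t
    using tendsto_uniform_limitI[OF F] by simp
  have le: "F a \<le> F b" if "a \<le> b" for a b
    by (rule LIMSEQ_le[OF lim lim])
       (use that sigma_lift_strict_mono in \<open>auto simp: le_less\<close>)
  show ?thesis
  proof (rule circle_homeomorphism_of_strictly_increasing_lift)
    fix t
    have "(\<lambda>N. cis (sigma_lift p r q N t)) \<longlonglongrightarrow> cis (F t)"
      by (intro tendsto_intros lim)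
    then show "sigma_lim p (\<lambda>n. complex_of_real (r n) * cis (q n)) (cis t) = cis (F t)"
      unfolding sigma_lim_def using r_bounds p_ge_1 by (simp add: sigmaN_cis limI)
    show "F (t + 2 * pi) = F t + 2 * pi"
      by (rule LIMSEQ_unique[OF lim]) (simp only: sigma_lift_periodic, intro tendsto_intros lim)
  next
    show "continuous_on UNIV F"
      by (rule uniform_limit_theorem[OF _ F]) (simp_all add: continuous_on_sigma_lift)
    show "strict_mono F"
    proof (rule strict_monoI)
      fix x y :: real assume "x < y"
      then obtain a where a: "x < of_rat a" "of_rat a < y" using of_rat_dense by blast
      then obtain b where b: "of_rat a < (of_rat b :: real)" "of_rat b < y" using of_rat_dense by blast
      have "(\<lambda>N. sigma_lift p r q N (of_rat b) - sigma_lift p r q N (of_rat a))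
          \<longlonglongrightarrow> F (of_rat b) - F (of_rat a)"
        by (intro tendsto_intros lim)
      moreover have "a < b" using b(1) by (simp add: of_rat_less)
      ultimately have "F (of_rat b) \<noteq> F (of_rat a)" using gap by fastforce
      then show "F x < F y"
        using le[of x "of_rat a"] le[of "of_rat a" "of_rat b"] le[of "of_rat b" y] a b by auto
    qed
  qed
qed

end

section \<open>Probabilistic tools\<close>

text \<open>Fatou's lemma applied to \<open>1/X\<^sub>N\<close>, whose lower limit is infinite wherever \<open>X\<^sub>N\<close> tends to zero.\<close>

lemma (in prob_space) AE_not_tendsto_zero:
  fixes X :: "nat \<Rightarrow> 'a \<Rightarrow> real"
  assumes meas[measurable]: "\<And>N. X N \<in> borel_measurable M"
    and pos: "\<And>N \<omega>. X N \<omega> > 0"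
    and int: "\<And>N. integrable M (\<lambda>\<omega>. 1 / X N \<omega>)"
    and bound: "\<And>N. expectation (\<lambda>\<omega>. 1 / X N \<omega>) \<le> K"
  shows "AE \<omega> in M. \<not> (\<lambda>N. X N \<omega>) \<longlonglongrightarrow> 0"
proof -
  have "(\<integral>\<^sup>+\<omega>. liminf (\<lambda>N. ennreal (1 / X N \<omega>)) \<partial>M)
      \<le> liminf (\<lambda>N. \<integral>\<^sup>+\<omega>. ennreal (1 / X N \<omega>) \<partial>M)"
    by (rule nn_integral_liminf) simp
  also have "\<dots> \<le> liminf (\<lambda>N. ennreal K)"
    by (intro Liminf_mono always_eventually allI, subst nn_integral_eq_integral[OF int])
       (use pos bound in \<open>auto intro: ennreal_leI simp: less_imp_le\<close>)
  also have "\<dots> < \<infinity>" by (simp add: Liminf_const)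
  finally have "AE \<omega> in M. liminf (\<lambda>N. ennreal (1 / X N \<omega>)) \<noteq> \<infinity>"
    by (intro nn_integral_PInf_AE) auto
  then show ?thesis
  proof eventually_elim
    case (elim \<omega>)
    show ?case
    proof
      assume "(\<lambda>N. X N \<omega>) \<longlonglongrightarrow> 0"
      then have "filterlim (\<lambda>N. X N \<omega>) (at_right 0) sequentially"
        using pos by (simp add: filterlim_at less_imp_neq[OF pos, THEN not_sym])
      then have "filterlim (\<lambda>N. 1 / X N \<omega>) at_top sequentially"
        using filterlim_compose[OF filterlim_inverse_at_top_right] by (simp add: inverse_eq_divide)
      then have "(\<lambda>N. ennreal (1 / X N \<omega>)) \<longlonglongrightarrow> \<infinity>"
        by (simp add: ennreal_tendsto_top_eq_at_top)
      with elim show False using lim_imp_Liminf[OF sequentially_bot] by blast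
    qed
  qed
qed

lemma (in prob_space) uniform_phase_mean_zero:
  fixes f F :: "real \<Rightarrow> real"
  assumes X: "X \<in> borel_measurable M"
    and distr: "distr M borel X = uniform_measure lborel {0..<2 * pi}"
    and F: "\<And>x. (F has_real_derivative f x) (at x)"
    and f: "continuous_on UNIV f"
    and per: "F (2 * pi) = F 0"
  shows "expectation (\<lambda>\<omega>. f (X \<omega>)) = 0"
proof -
  have fm [measurable]: "f \<in> borel_measurable borel"
    using f by (rule borel_measurable_continuous_onI)
  have "1 / ennreal (2 * pi) = ennreal (1 / (2 * pi))"
    using divide_ennreal[of 1 "2 * pi"] by simp
  then have dens: "uniform_measure lborel {0..<2 * pi}
      = density lborel (\<lambda>x. ennreal (indicator {0..<2 * pi} x / (2 * pi)))"
    unfolding uniform_measure_def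
    by (intro density_cong) (auto simp: indicator_def)
  have "expectation (\<lambda>\<omega>. f (X \<omega>)) = (\<integral>x. f x \<partial>distr M borel X)"
    using X by (simp add: integral_distr)
  also have "\<dots> = (\<integral>x. (indicator {0..<2 * pi} x / (2 * pi)) *\<^sub>R f x \<partial>lborel)"
    unfolding distr dens by (rule integral_density) auto
  \<comment> \<open>The endpoint \<open>2\<pi>\<close> is a null set.\<close>
  also have "\<dots> = (\<integral>x. f x * indicator {0..2 * pi} x / (2 * pi) \<partial>lborel)"
    using AE_lborel_singleton[of "2 * pi"]
    by (intro integral_cong_AE) (auto simp: indicator_def elim!: eventually_mono)
  also have "\<dots> = (\<integral>x. f x * indicator {0..2 * pi} x \<partial>lborel) / (2 * pi)"
    by simp
  also have "(\<integral>x. f x * indicator {0..2 * pi} x \<partial>lborel) = F (2 * pi) - F 0"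
    using F f by (intro integral_FTC_Icc_real) (auto simp: continuous_on_eq_continuous_at)
  finally show ?thesis using per by simp
qed

text \<open>
  The hypothesis on \<open>restrict\<close> says that \<open>G\<close> depends only on the coordinates in \<open>A\<close>. Thus \<open>G\<close> of the phases
  is a function of the family \<open>(q\<^sub>i)\<close> for \<open>i \<in> A\<close>, which is independent of \<open>q\<^sub>j\<close>, and the expectation
  of the product factors.
\<close>

lemma (in prob_space) expectation_past_times_phase_zero:
  fixes q :: "nat \<Rightarrow> 'a \<Rightarrow> real" and G :: "(nat \<Rightarrow> real) \<Rightarrow> real"
  assumes indep: "indep_vars (\<lambda>_. borel) q I"
    and A: "A \<subseteq> I" "j \<in> I" "j \<notin> A"
    and G: "G \<in> borel_measurable (Pi\<^sub>M A (\<lambda>_. borel))"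
    and local: "\<And>x. G (restrict x A) = G x"
    and Gint: "integrable M (\<lambda>\<omega>. G (\<lambda>i. q i \<omega>))"
    and h: "h \<in> borel_measurable borel" "integrable M (\<lambda>\<omega>. h (q j \<omega>))"
      "expectation (\<lambda>\<omega>. h (q j \<omega>)) = 0"
  shows "integrable M (\<lambda>\<omega>. G (\<lambda>i. q i \<omega>) * h (q j \<omega>))"
    and "expectation (\<lambda>\<omega>. G (\<lambda>i. q i \<omega>) * h (q j \<omega>)) = 0"
proof -
  have "indep_var (Pi\<^sub>M A (\<lambda>_. borel)) (\<lambda>\<omega>. restrict (\<lambda>i. q i \<omega>) A)
      (Pi\<^sub>M {j} (\<lambda>_. borel)) (\<lambda>\<omega>. restrict (\<lambda>i. q i \<omega>) {j})"
    by (rule indep_var_restrict[OF indep]) (use A in auto)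
  from indep_var_compose[OF this G, of "\<lambda>x. h (x j)" borel] h(1)
  have ind: "indep_var borel (\<lambda>\<omega>. G (\<lambda>i. q i \<omega>)) borel (\<lambda>\<omega>. h (q j \<omega>))"
    by (simp add: o_def local)
  show "integrable M (\<lambda>\<omega>. G (\<lambda>i. q i \<omega>) * h (q j \<omega>))"
    by (rule indep_var_integrable[OF ind Gint h(2)])
  show "expectation (\<lambda>\<omega>. G (\<lambda>i. q i \<omega>) * h (q j \<omega>)) = 0"
    using indep_var_lebesgue_integral[OF ind Gint h(2)] h(3) by simp
qed

section \<open>The expected reciprocal length\<close>

lemma borel_measurable_circle_lift [measurable]:
  assumes [measurable]: "Q \<in> borel_measurable N" "T \<in> borel_measurable N"
  shows "(\<lambda>x. circle_lift n r (Q x) (T x)) \<in> borel_measurable N"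
  unfolding circle_lift_def by measurable

text \<open>
  The next two lemmas record that the \<open>N\<close>-th composition sees only the phases with index in \<open>p ` {1..N}\<close>.
\<close>

lemma sigma_lift_borel_measurable:
  assumes "\<And>i. i \<in> p ` {1..N} \<Longrightarrow> (\<lambda>x. Q x i) \<in> borel_measurable L"
  shows "(\<lambda>x. sigma_lift p r (Q x) N t) \<in> borel_measurable L"
  using assms
proof (induction N)
  case (Suc N)
  have "(\<lambda>x. Q x (p (Suc N))) \<in> borel_measurable L"
    by (rule Suc.prems) simp
  moreover have "(\<lambda>x. sigma_lift p r (Q x) N t) \<in> borel_measurable L"
    by (rule Suc.IH, rule Suc.prems) auto
  ultimately show ?case by simp
qed simp

lemma sigma_lift_cong:
  assumes "\<And>i. i \<in> p ` {1..N} \<Longrightarrow> q i = q' i"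
  shows "sigma_lift p r q N t = sigma_lift p r q' N t"
  using assms
proof (induction N)
  case (Suc N)
  have "q (p (Suc N)) = q' (p (Suc N))"
    by (rule Suc.prems) simp
  moreover have "sigma_lift p r q N t = sigma_lift p r q' N t"
    by (rule Suc.IH, rule Suc.prems) auto
  ultimately show ?case by simp
qed simp

context phase_chain
begin

lemma sigma_lift_reciprocal_gap_le:
  assumes "a < b"
  shows "1 / (sigma_lift p r q N b - sigma_lift p r q N a)
    \<le> (\<Prod>i<N. (1 + r (p (Suc i))) / (1 - r (p (Suc i)))) * (1 / (b - a))"
proof (induction N)
  case (Suc N)
  let ?c = "(1 + r (p (Suc N))) / (1 - r (p (Suc N)))"
  have "1 / (sigma_lift p r q (Suc N) b - sigma_lift p r q (Suc N) a)
      \<le> ?c * (1 / (sigma_lift p r q N b - sigma_lift p r q N a))"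
    using circle_lift_increment_bound[OF p_Suc_pos r_p_bounds sigma_lift_strict_mono[OF assms]]
    by simp
  also have "\<dots> \<le> ?c * ((\<Prod>i<N. (1 + r (p (Suc i))) / (1 - r (p (Suc i)))) * (1 / (b - a)))"
    using Suc r_p_bounds[of N] by (intro mult_left_mono) auto
  finally show ?case by (simp add: mult_ac)
qed simp

text \<open>
  Each factor is \<open>1 + e\<close> with \<open>e = 2 r\<^sup>2 / (1 - r\<^sup>2)\<close>, and \<open>e \<le> 4 r\<^sup>2\<close> once \<open>r\<^sup>2 < 1/2\<close>; so
  the product is at most \<open>exp\<close> of a convergent series.
\<close>

lemma bounded_prod_mean_stretch:
  assumes "summable (\<lambda>n. (r n)\<^sup>2)"
  shows "\<exists>K. \<forall>N. (\<Prod>i<N. (1 + (r (p (Suc i)))\<^sup>2) / (1 - (r (p (Suc i)))\<^sup>2)) \<le> K"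
proof -
  \<comment> \<open>The absolute value matters only at index \<open>0\<close>, where \<open>r\<close> is unconstrained.\<close>
  let ?e = "\<lambda>n. \<bar>2 * (r n)\<^sup>2 / (1 - (r n)\<^sup>2)\<bar>"
  have "eventually (\<lambda>n. (r n)\<^sup>2 < 1/2) sequentially"
    using summable_LIMSEQ_zero[OF assms] by (rule order_tendstoD) simp
  then have "eventually (\<lambda>n. norm (?e n) \<le> 4 * (r n)\<^sup>2) sequentially"
  proof eventually_elim
    case (elim n)
    have "2 * (r n)\<^sup>2 / (1 - (r n)\<^sup>2) \<le> 2 * (r n)\<^sup>2 / (1/2)"
      using elim by (intro divide_left_mono) auto
    then show ?case using elim by simp
  qed
  then have "summable ?e"
    using assms by (rule summable_comparison_test_ev[OF _ summable_mult])
  then have sum: "summable (\<lambda>N. ?e (p (Suc N)))"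
    by (rule summable_nonneg_reindex_p) simp
  have "(\<Prod>i<N. (1 + (r (p (Suc i)))\<^sup>2) / (1 - (r (p (Suc i)))\<^sup>2)) \<le> exp (\<Sum>i. ?e (p (Suc i)))" for N
  proof -
    have "(\<Prod>i<N. (1 + (r (p (Suc i)))\<^sup>2) / (1 - (r (p (Suc i)))\<^sup>2)) \<le> (\<Prod>i<N. exp (?e (p (Suc i))))"
    proof (intro prod_mono conjI)
      fix i
      have pos: "1 - (r (p (Suc i)))\<^sup>2 > 0"
        using r_p_bounds[of i] by (simp add: power_less_one_iff)
      then show "0 \<le> (1 + (r (p (Suc i)))\<^sup>2) / (1 - (r (p (Suc i)))\<^sup>2)" by simp
      have "(1 + (r (p (Suc i)))\<^sup>2) / (1 - (r (p (Suc i)))\<^sup>2) = 1 + ?e (p (Suc i))"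
        using pos by (simp add: field_simps)
      then show "(1 + (r (p (Suc i)))\<^sup>2) / (1 - (r (p (Suc i)))\<^sup>2) \<le> exp (?e (p (Suc i)))"
        using exp_ge_add_one_self by simp
    qed
    also have "\<dots> = exp (\<Sum>i<N. ?e (p (Suc i)))" by (simp add: exp_sum)
    also have "\<dots> \<le> exp (\<Sum>i. ?e (p (Suc i)))"
      using sum by (simp add: sum_le_suminf)
    finally show ?thesis .
  qed
  then show ?thesis by blast
qed

end

locale random_phase_chain = phase_chain p r + prob_space M
  for p :: "nat \<Rightarrow> nat" and r :: "nat \<Rightarrow> real" and M :: "'a measure" +
  fixes q :: "nat \<Rightarrow> 'a \<Rightarrow> real"
  assumes indep: "indep_vars (\<lambda>_. borel) q {1..}"
    and uniform: "n \<ge> 1 \<Longrightarrow> distr M borel (q n) = uniform_measure lborel {0..<2 * pi}"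
begin

definition gap :: "real \<Rightarrow> real \<Rightarrow> nat \<Rightarrow> (nat \<Rightarrow> real) \<Rightarrow> real" where
  "gap a b N x = sigma_lift p r x N b - sigma_lift p r x N a"

lemma gap_pos: "a < b \<Longrightarrow> gap a b N x > 0"
  using sigma_lift_strict_mono by (simp add: gap_def)

lemma q_measurable: "n \<ge> 1 \<Longrightarrow> q n \<in> borel_measurable M"
  using indep by (simp add: indep_vars_def2)

lemma sigma_lift_q_measurable [measurable]:
  "(\<lambda>\<omega>. sigma_lift p r (\<lambda>i. q i \<omega>) N t) \<in> borel_measurable M"
  by (rule sigma_lift_borel_measurable) (use p_ge_1 in \<open>auto intro!: q_measurable\<close>)

lemma gap_measurable [measurable]: "(\<lambda>\<omega>. gap a b N (\<lambda>i. q i \<omega>)) \<in> borel_measurable M"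
  unfolding gap_def by measurable

lemma ex_reciprocal_gap_bound:
  assumes "a < b"
  shows "\<exists>B. \<forall>x. \<bar>1 / gap a b N x\<bar> \<le> B"
proof (intro exI allI)
  show "\<bar>1 / gap a b N x\<bar> \<le> (\<Prod>i<N. (1 + r (p (Suc i))) / (1 - r (p (Suc i)))) * (1 / (b - a))" for x
    using sigma_lift_reciprocal_gap_le[OF assms, of x N] gap_pos[OF assms, of N x] by (simp add: gap_def)
qed

lemma integrable_reciprocal_gap:
  assumes "a < b"
  shows "integrable M (\<lambda>\<omega>. 1 / gap a b N (\<lambda>i. q i \<omega>))"
proof -
  obtain B where "\<And>x. \<bar>1 / gap a b N x\<bar> \<le> B" using ex_reciprocal_gap_bound[OF assms] by blast
  then show ?thesis by (intro integrable_const_bound[where B = B]) auto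
qed

text \<open>
  The arc after \<open>N\<close> steps is determined by phases that are independent of \<open>q\<close> at \<open>p (Suc N)\<close>, because \<open>p\<close> is
  injective. In the addition theorem for the oscillating term, \<open>\<phi>\<close> is the sine or cosine
  that carries the arc and \<open>h\<close> is the one that carries the new phase.
\<close>

lemma expectation_past_times_new_phase:
  assumes ab: "a < b"
    and phi: "\<phi> \<in> borel_measurable borel" "\<And>x. \<bar>\<phi> x\<bar> \<le> 1"
    and h: "h \<in> borel_measurable borel" "\<And>x. \<bar>h x\<bar> \<le> 1"
      "expectation (\<lambda>\<omega>. h (q (p (Suc N)) \<omega>)) = 0"
  defines "Y \<equiv> (\<lambda>x. (1 / gap a b N x)\<^sup>2 * (\<phi> (sigma_lift p r x N b) - \<phi> (sigma_lift p r x N a)))"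
  shows "integrable M (\<lambda>\<omega>. Y (\<lambda>i. q i \<omega>) * h (q (p (Suc N)) \<omega>))"
    and "expectation (\<lambda>\<omega>. Y (\<lambda>i. q i \<omega>) * h (q (p (Suc N)) \<omega>)) = 0"
proof -
  let ?A = "p ` {1..N}"
  note phi(1)[measurable] h(1)[measurable]
  have A: "?A \<subseteq> {1..}" "p (Suc N) \<in> {1..}" using p_ge_1 by auto
  have new: "p (Suc N) \<notin> ?A"
    using p_inj by (auto dest: inj_onD)
  have past [measurable]: "(\<lambda>x. sigma_lift p r x N t) \<in> borel_measurable (Pi\<^sub>M ?A (\<lambda>_. borel))" for t
    by (rule sigma_lift_borel_measurable) (rule measurable_component_singleton)
  have Y: "Y \<in> borel_measurable (Pi\<^sub>M ?A (\<lambda>_. borel))"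
    unfolding Y_def gap_def by measurable
  have restrict: "sigma_lift p r (restrict x ?A) N t = sigma_lift p r x N t" for x t
    by (rule sigma_lift_cong) simp
  have local: "Y (restrict x ?A) = Y x" for x
    unfolding Y_def gap_def restrict ..
  obtain B where B: "\<And>x. \<bar>1 / gap a b N x\<bar> \<le> B" using ex_reciprocal_gap_bound[OF ab] by blast
  have "\<bar>Y x\<bar> \<le> B\<^sup>2 * 2" for x
  proof -
    have "\<bar>\<phi> (sigma_lift p r x N b) - \<phi> (sigma_lift p r x N a)\<bar> \<le> 2"
      using phi(2)[of "sigma_lift p r x N b"] phi(2)[of "sigma_lift p r x N a"] by linarith
    moreover have "\<bar>(1 / gap a b N x)\<^sup>2\<bar> \<le> B\<^sup>2"
      using power_mono[OF B abs_ge_zero, of x 2] by (simp only: power2_abs abs_power2)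
    ultimately show ?thesis unfolding Y_def abs_mult by (intro mult_mono) auto
  qed
  then have Yint: "integrable M (\<lambda>\<omega>. Y (\<lambda>i. q i \<omega>))"
    unfolding Y_def by (intro integrable_const_bound[where B = "B\<^sup>2 * 2"]) auto
  have [measurable]: "q (p (Suc N)) \<in> borel_measurable M" by (rule q_measurable[OF p_Suc_pos])
  have hint: "integrable M (\<lambda>\<omega>. h (q (p (Suc N)) \<omega>))"
    by (rule integrable_const_bound[where B = 1]) (use h(2) in auto)
  note * = expectation_past_times_phase_zero[OF indep A new Y local Yint h(1) hint h(3)]
  show "integrable M (\<lambda>\<omega>. Y (\<lambda>i. q i \<omega>) * h (q (p (Suc N)) \<omega>))" by (rule *(1))
  show "expectation (\<lambda>\<omega>. Y (\<lambda>i. q i \<omega>) * h (q (p (Suc N)) \<omega>)) = 0" by (rule *(2))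
qed

text \<open>
  By the addition theorem, the oscillating term of \<open>circle_lift_reciprocal_increment\<close> splits into two
  products \<open>S\<close> and \<open>T\<close> of a function of the past with \<open>cos q\<close> or \<open>sin q\<close>, both of mean zero.
\<close>

lemma expectation_reciprocal_gap_Suc:
  assumes ab: "a < b"
  shows "expectation (\<lambda>\<omega>. 1 / gap a b (Suc N) (\<lambda>i. q i \<omega>))
    \<le> (1 + (r (p (Suc N)))\<^sup>2) / (1 - (r (p (Suc N)))\<^sup>2) * expectation (\<lambda>\<omega>. 1 / gap a b N (\<lambda>i. q i \<omega>))"
proof -
  define n where "n = p (Suc N)"
  define \<alpha> where "\<alpha> = 2 * r n / (real n * (1 - (r n)\<^sup>2))"
  let ?C = "(1 + (r n)\<^sup>2) / (1 - (r n)\<^sup>2)"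
  let ?a = "\<lambda>\<omega>. sigma_lift p r (\<lambda>i. q i \<omega>) N a" and ?b = "\<lambda>\<omega>. sigma_lift p r (\<lambda>i. q i \<omega>) N b"
  define W where "W = (\<lambda>\<omega>. 1 / gap a b N (\<lambda>i. q i \<omega>))"
  define S where "S = (\<lambda>\<omega>. (W \<omega>)\<^sup>2 * (sin (real n * ?b \<omega>) - sin (real n * ?a \<omega>)) * cos (q n \<omega>))"
  define T where "T = (\<lambda>\<omega>. (W \<omega>)\<^sup>2 * (cos (real n * ?b \<omega>) - cos (real n * ?a \<omega>)) * sin (q n \<omega>))"
  have n: "n \<ge> 1" unfolding n_def by (rule p_Suc_pos)
  note mean = uniform_phase_mean_zero[OF q_measurable[OF n] uniform[OF n]]
  have mean_cos: "expectation (\<lambda>\<omega>. cos (q n \<omega>)) = 0"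
    by (rule mean[where F = sin]) (auto intro!: DERIV_sin continuous_intros)
  have mean_sin: "expectation (\<lambda>\<omega>. sin (q n \<omega>)) = 0"
    by (rule mean[where F = "\<lambda>x. - cos x"]) (auto intro!: derivative_eq_intros continuous_intros)
  have S: "integrable M S" "expectation S = 0"
    using expectation_past_times_new_phase[OF ab, of "\<lambda>x. sin (real n * x)" cos N] mean_cos
    by (simp_all add: n_def S_def W_def)
  have T: "integrable M T" "expectation T = 0"
    using expectation_past_times_new_phase[OF ab, of "\<lambda>x. cos (real n * x)" sin N] mean_sin
    by (simp_all add: n_def T_def W_def)
  have W: "integrable M W" unfolding W_def by (rule integrable_reciprocal_gap[OF ab])
  have "1 / gap a b (Suc N) (\<lambda>i. q i \<omega>) \<le> ?C * W \<omega> + \<alpha> * (S \<omega> + T \<omega>)" for \<omega>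
  proof -
    have "1 / gap a b (Suc N) (\<lambda>i. q i \<omega>) \<le> ?C * W \<omega> + \<alpha> * ((W \<omega>)\<^sup>2 *
        (sin (real n * ?b \<omega> + q n \<omega>) - sin (real n * ?a \<omega> + q n \<omega>)))"
      using circle_lift_reciprocal_increment[OF n _ _ sigma_lift_strict_mono[OF ab], of "r n"] r_p_bounds[of N]
      by (simp add: gap_def n_def \<alpha>_def W_def)
    also have "(W \<omega>)\<^sup>2 * (sin (real n * ?b \<omega> + q n \<omega>) - sin (real n * ?a \<omega> + q n \<omega>)) = S \<omega> + T \<omega>"
      by (simp add: S_def T_def sin_add algebra_simps)
    finally show ?thesis .
  qed
  moreover have "integrable M (\<lambda>\<omega>. ?C * W \<omega> + \<alpha> * (S \<omega> + T \<omega>))"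
    using W S(1) T(1) by simp
  ultimately have "expectation (\<lambda>\<omega>. 1 / gap a b (Suc N) (\<lambda>i. q i \<omega>))
      \<le> expectation (\<lambda>\<omega>. ?C * W \<omega> + \<alpha> * (S \<omega> + T \<omega>))"
    by (intro integral_mono integrable_reciprocal_gap[OF ab])
  also have "\<dots> = ?C * expectation W" using W S T by simp
  finally show ?thesis by (simp only: n_def W_def)
qed

lemma expectation_reciprocal_gap_le:
  assumes ab: "a < b"
  shows "expectation (\<lambda>\<omega>. 1 / gap a b N (\<lambda>i. q i \<omega>))
    \<le> (\<Prod>i<N. (1 + (r (p (Suc i)))\<^sup>2) / (1 - (r (p (Suc i)))\<^sup>2)) * (1 / (b - a))"
proof (induction N)
  case 0
  then show ?case by (simp add: gap_def prob_space)
next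
  case (Suc N)
  let ?C = "\<lambda>i. (1 + (r (p (Suc i)))\<^sup>2) / (1 - (r (p (Suc i)))\<^sup>2)"
  have "?C N \<ge> 0" using r_p_bounds[of N] by (simp add: power_le_one)
  then have "?C N * expectation (\<lambda>\<omega>. 1 / gap a b N (\<lambda>i. q i \<omega>)) \<le> ?C N * ((\<Prod>i<N. ?C i) * (1 / (b - a)))"
    using Suc by (rule mult_left_mono[rotated])
  also have "\<dots> = (\<Prod>i<Suc N. ?C i) * (1 / (b - a))" by simp
  finally show ?case using expectation_reciprocal_gap_Suc[OF ab, of N] by (rule order_trans[rotated])
qed

lemma AE_gap_not_tendsto_zero:
  assumes ab: "a < b" and "summable (\<lambda>n. (r n)\<^sup>2)"
  shows "AE \<omega> in M. \<not> (\<lambda>N. gap a b N (\<lambda>i. q i \<omega>)) \<longlonglongrightarrow> 0"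
proof -
  obtain K where K: "\<And>N. (\<Prod>i<N. (1 + (r (p (Suc i)))\<^sup>2) / (1 - (r (p (Suc i)))\<^sup>2)) \<le> K"
    using bounded_prod_mean_stretch[OF assms(2)] by blast
  have "expectation (\<lambda>\<omega>. 1 / gap a b N (\<lambda>i. q i \<omega>)) \<le> K * (1 / (b - a))" for N
    using expectation_reciprocal_gap_le[OF ab, of N] mult_right_mono[OF K[of N], of "1 / (b - a)"] ab
    by simp
  then show ?thesis
    by (intro AE_not_tendsto_zero integrable_reciprocal_gap gap_measurable gap_pos ab)
qed

end

section \<open>Almost sure homeomorphism\<close>

theorem theorem3:
  fixes p :: "nat \<Rightarrow> nat"
    and r :: "nat \<Rightarrow> real"
    and M :: "'a measure"
    and q :: "nat \<Rightarrow> 'a \<Rightarrow> real"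
  assumes "bij_betw p {1..} {1..}"
    and "\<And>n. n \<ge> 1 \<Longrightarrow> 0 \<le> r n \<and> r n < 1"
    and "summable (\<lambda>n. (r n)\<^sup>2)"
    and "prob_space M"
    and "prob_space.indep_vars M (\<lambda>_. borel) q {1..}"
    and "\<And>n. n \<ge> 1 \<Longrightarrow> distr M borel (q n) = uniform_measure lborel {0..<2 * pi}"
  shows "AE \<omega> in M.
    \<exists>g. homeomorphism (sphere 0 1) (sphere 0 1)
          (sigma_lim p (\<lambda>n. complex_of_real (r n) * cis (q n \<omega>))) g"
proof -
  interpret prob_space M by fact
  interpret random_phase_chain p r M q
    using assms(1,2,5,6) by unfold_locales (auto simp: bij_betw_def)
  have "AE \<omega> in M. \<forall>(a::rat) (b::rat). a < b \<longrightarrow>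
      \<not> (\<lambda>N. gap (of_rat a) (of_rat b) N (\<lambda>i. q i \<omega>)) \<longlonglongrightarrow> 0"
    using AE_gap_not_tendsto_zero[OF _ assms(3)] by (simp add: AE_all_countable of_rat_less)
  then show ?thesis
    by eventually_elim
       (rule homeomorphism_sigma_lim[OF assms(3)], simp add: gap_def)
qed

end
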